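(* Let $f:\mathbb{R}^n\to\mathbb{R}^n$ and $h:\mathbb{R}^n\to\mathbb{R}^p$ be locally Lipschitz and let $\mathcal{O}\subset\mathbb{R}^n$ be open. Assume that the system $\dot x=f(x)$, $y=h(x)$ is forward complete within $\mathcal{O}$ and that there exist an integer $m$, a Hurwitz complex $m\times m$ matrix $A$, continuous functions $T:\mathrm{cl}(\mathcal{O})\to\mathbb{C}^{m\times p}$ and $B:\mathbb{R}^p\to\mathbb{C}^{m\times p}$, and a function $\rho$ of class $\mathcal{K}_\infty$ satisfying $$L_fT(x)=A\,T(x)+B(h(x))\qquad\forall x\in\mathcal{O},$$ $$|x_1-x_2|\le\rho(|T(x_1)-T(x_2)|)\qquad\forall (x_1,x_2)\in\mathrm{cl}(\mathcal{O})^2 .$$ Then there exists a continuous function $T^*:\mathbb{C}^{m\times p}\to\mathrm{cl}(\mathcal{O})$ such that, for each $x\in\mathcal{O}$ and $z\in\mathbb{C}^{m\times p}$, the (unique) solution $(X(x,t),Z(x,z,t))$, with initial condition $(x,z)$ at $t=0$, of $$\dot x=f(x),\qquad \dot z=Az+B(h(x))$$ is right maximally defined on $[0,\sigma^+_{\mathbb{R}^n}(x))$. Moreover, we have the implication $$\sigma^+_{\mathcal{O}}(x)=\sigma^+_{\mathbb{R}^n}(x)\ \Longrightarrow\ \lim_{t\to\sigma^+_{\mathbb{R}^n}(x)}\left|T^*(Z(x,z,t))-X(x,t)\right|=0 .$$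
   Context: For $x\in\mathbb{R}^n$, $X(x,t)$ denotes the unique maximal solution of $\dot x=f(x)$ with initial condition $x$ at $t=0$. For an open set $\mathcal{O}$ and $x\in\mathcal{O}$, $(\sigma^-_{\mathcal{O}}(x),\sigma^+_{\mathcal{O}}(x))$ is the maximal interval (containing $0$) of definition of the solution $X(x,t)$ conditioned to take values in $\mathcal{O}$; in particular $(\sigma^-_{\mathbb{R}^n}(x),\sigma^+_{\mathbb{R}^n}(x))$ is its maximal interval of definition. Forward completeness within $\mathcal{O}$: for each $x\in\mathcal{O}$, $\sigma^+_{\mathcal{O}}(x)<+\infty$ implies $\sigma^+_{\mathcal{O}}(x)<\sigma^+_{\mathbb{R}^n}(x)$. $\mathrm{cl}$ denotes closure. $L_fT(x)=\lim_{\tau\to0}\frac{T(X(x,\tau))-T(x)}{\tau}$ is the Lie derivative of $T$ along $f$ (the displayed equation includes that this limit exists on $\mathcal{O}$). A matrix is Hurwitz if all its eigenvalues have strictly negative real part. A class $\mathcal{K}_\infty$ function is a continuous, strictly increasing, unbounded function $\mathbb{R}_+\to\mathbb{R}_+$ vanishing at $0$. $|\cdot|$ denotes a norm on the relevant space of vectors or matrices.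
   Formalization: T* is only claimed to take values in the convex hull of cl(O), and in cl(O) on T(cl(O)), since a continuous T* into cl(O) need not exist (f=0, h=id, A=-1, T=B=inclusion, O={|x|>1}); O is assumed nonempty. *)

theory Defs
  imports "HOL-Analysis.Analysis"
begin

definition solution ::
  "('a::real_normed_vector \<Rightarrow> 'a) \<Rightarrow> 'a set \<Rightarrow> 'a \<Rightarrow> real set \<Rightarrow> (real \<Rightarrow> 'a) \<Rightarrow> bool"
  where "solution g S x I \<phi> \<longleftrightarrow>
    open I \<and> is_interval I \<and> 0 \<in> I \<and> \<phi> 0 = x \<and>
    (\<forall>t\<in>I. \<phi> t \<in> S \<and> (\<phi> has_vector_derivative g (\<phi> t)) (at t))"

definition maximal_solution ::
  "('a::real_normed_vector \<Rightarrow> 'a) \<Rightarrow> 'a set \<Rightarrow> 'a \<Rightarrow> real set \<Rightarrow> (real \<Rightarrow> 'a) \<Rightarrow> bool"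
  where "maximal_solution g S x I \<phi> \<longleftrightarrow>
    solution g S x I \<phi> \<and>
    (\<forall>J \<psi>. solution g S x J \<psi> \<and> I \<subseteq> J \<and> (\<forall>t\<in>I. \<psi> t = \<phi> t) \<longrightarrow> J = I)"

(* Solutions are compared on their interval of definition only, since functions are total. *)
definition unique_maximal_solution ::
  "('a::real_normed_vector \<Rightarrow> 'a) \<Rightarrow> 'a set \<Rightarrow> 'a \<Rightarrow> real set \<Rightarrow> (real \<Rightarrow> 'a) \<Rightarrow> bool"
  where "unique_maximal_solution g S x I \<phi> \<longleftrightarrow>
    maximal_solution g S x I \<phi> \<and>
    (\<forall>J \<psi>. maximal_solution g S x J \<psi> \<longrightarrow> J = I \<and> (\<forall>t\<in>I. \<psi> t = \<phi> t))"

(* The descriptions below denote the intended objects whenever the maximal solution is unique,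
   in particular for a locally Lipschitz vector field and an open set S containing x. *)

definition max_interval ::
  "('a::real_normed_vector \<Rightarrow> 'a) \<Rightarrow> 'a set \<Rightarrow> 'a \<Rightarrow> real set"
  where "max_interval g S x = (THE I. \<exists>\<phi>. maximal_solution g S x I \<phi>)"

definition flow :: "('a::real_normed_vector \<Rightarrow> 'a) \<Rightarrow> 'a \<Rightarrow> real \<Rightarrow> 'a"
  where "flow g x t = (THE y. \<exists>I \<phi>. maximal_solution g UNIV x I \<phi> \<and> t \<in> I \<and> \<phi> t = y)"

definition sigma_plus :: "('a::real_normed_vector \<Rightarrow> 'a) \<Rightarrow> 'a set \<Rightarrow> 'a \<Rightarrow> ereal"
  where "sigma_plus g S x = (SUP t\<in>max_interval g S x. ereal t)"

definition forward_complete_within :: "('a::real_normed_vector \<Rightarrow> 'a) \<Rightarrow> 'a set \<Rightarrow> bool"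
  where "forward_complete_within g S \<longleftrightarrow>
    (\<forall>x\<in>S. sigma_plus g S x < \<infinity> \<longrightarrow> sigma_plus g S x < sigma_plus g UNIV x)"

definition has_lie_derivative ::
  "('a::real_normed_vector \<Rightarrow> 'b::real_normed_vector) \<Rightarrow> ('a \<Rightarrow> 'a) \<Rightarrow> 'b \<Rightarrow> 'a \<Rightarrow> bool"
  where "has_lie_derivative T g D x \<longleftrightarrow>
    ((\<lambda>\<tau>. (T (flow g x \<tau>) - T x) /\<^sub>R \<tau>) \<longlongrightarrow> D) (at 0)"

definition hurwitz :: "complex^'m^'m \<Rightarrow> bool"
  where "hurwitz A \<longleftrightarrow> (\<forall>c v. v \<noteq> 0 \<and> A *v v = c *s v \<longrightarrow> Re c < 0)"

definition class_K_inf :: "(real \<Rightarrow> real) \<Rightarrow> bool"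
  where "class_K_inf \<rho> \<longleftrightarrow>
    continuous_on {0..} \<rho> \<and> strict_mono_on {0..} \<rho> \<and> \<not> bounded (\<rho> ` {0..}) \<and> \<rho> 0 = 0"

definition observer_field ::
  "(real^'n \<Rightarrow> real^'n) \<Rightarrow> (real^'n \<Rightarrow> real^'p) \<Rightarrow> complex^'m^'m \<Rightarrow> (real^'p \<Rightarrow> complex^'p^'m)
    \<Rightarrow> (real^'n) \<times> (complex^'p^'m) \<Rightarrow> (real^'n) \<times> (complex^'p^'m)"
  where "observer_field f h A B = (\<lambda>(x, z). (f x, A ** z + B (h x)))"

(* On the values of the observer output map: a continuous map defined on all complex m x p matrices
   cannot in general take its values in cl(O) only. For f = 0, h = id, A = -1 and
   T = B = the inclusion of the reals into the complex numbers, it would be a left inverse of T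
   on O, which is impossible for O = {x. 1 < |x|} since cl(O) is disconnected. The theorem
   therefore asks for values in the convex hull of cl(O), and in cl(O) on the image T(cl(O));
   when cl(O) is convex these are values in cl(O). *)

end

theory Submission
  imports Defs "HOL-Computational_Algebra.Fundamental_Theorem_Algebra"
begin

text \<open>
  Along a solution staying in \<open>\<O>\<close> the error \<open>Z - T(X)\<close> solves the linear equation \<open>E' = A E\<close>, hence
  tends to zero because \<open>A\<close> is Hurwitz. The inequality on \<open>\<rho>\<close> makes \<open>T\<close> injective on \<open>cl(\<O>)\<close> with a
  closed image and an inverse that has modulus of continuity \<open>\<rho>\<close>. A Dugundji extension \<open>Tstar\<close> of this
  inverse still satisfies \<open>|Tstar z - x| \<le> \<rho> (4 |z - T x|)\<close> for all \<open>z\<close> and all \<open>x\<close> in \<open>cl(\<O>)\<close>;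
  this uniform bound, stronger than continuity, is what the conclusion needs when \<open>T(X)\<close> is unbounded.
  Forward completeness forces \<open>\<sigma>\<^sup>+ = \<infinity>\<close> whenever the two maximal times agree. As \<open>B\<close> is only
  continuous, the extended field need not be locally Lipschitz; uniqueness for it comes from the
  cascade structure.
\<close>

section \<open>Solutions of differential equations\<close>

lemma has_vector_derivative_reflect:
  assumes "(D has_vector_derivative D') (at (- t))"
  shows "((\<lambda>s. D (- s)) has_vector_derivative - D') (at t)"
proof -
  have "(uminus has_vector_derivative - 1) (at t)"
    by (auto intro!: derivative_eq_intros)
  from vector_diff_chain_at[OF this assms] show ?thesis
    by (simp add: o_def)
qed

lemma deriv_bound_imp_zero:
  fixes D :: "real \<Rightarrow> 'a::real_inner"
  assumes "D 0 = 0"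
    and deriv: "\<And>s. s \<in> closed_segment 0 t \<Longrightarrow> (D has_vector_derivative D' s) (at s)"
    and bound: "\<And>s. s \<in> closed_segment 0 t \<Longrightarrow> norm (D' s) \<le> L * norm (D s)"
  shows "D t = 0"
proof -
  have pos: "D t = 0"
    if "0 \<le> t" "D 0 = 0" and deriv: "\<And>s. s \<in> {0..t} \<Longrightarrow> (D has_vector_derivative D' s) (at s)"
      and bound: "\<And>s. s \<in> {0..t} \<Longrightarrow> norm (D' s) \<le> L * norm (D s)"
    for t and D D' :: "real \<Rightarrow> 'a"
  proof -
    define V where "V s = exp (- 2 * L * s) * (D s \<bullet> D s)" for s
    have "V t \<le> V 0"
    proof (rule DERIV_nonpos_imp_nonincreasing[OF \<open>0 \<le> t\<close>])
      fix s assume "0 \<le> s" "s \<le> t"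
      then have s: "s \<in> {0..t}" by simp
      have "((\<lambda>s. D s \<bullet> D s) has_real_derivative 2 * (D s \<bullet> D' s)) (at s)"
        unfolding has_field_derivative_def
        by (rule has_derivative_eq_rhs[OF has_derivative_inner[OF deriv[OF s, unfolded has_vector_derivative_def]
              deriv[OF s, unfolded has_vector_derivative_def]]])
          (simp add: fun_eq_iff inner_commute)
      then have "(V has_real_derivative
          exp (- 2 * L * s) * (2 * (D s \<bullet> D' s)) - 2 * L * exp (- 2 * L * s) * (D s \<bullet> D s)) (at s)"
        unfolding V_def by (auto intro!: derivative_eq_intros simp: algebra_simps)
      moreover have "D s \<bullet> D' s \<le> L * (D s \<bullet> D s)"
      proof -
        have "D s \<bullet> D' s \<le> norm (D s) * norm (D' s)"
          by (rule norm_cauchy_schwarz)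
        also have "\<dots> \<le> norm (D s) * (L * norm (D s))"
          by (intro mult_left_mono bound s) auto
        finally show ?thesis
          by (simp add: dot_square_norm power2_eq_square algebra_simps)
      qed
      then have "exp (- 2 * L * s) * (2 * (D s \<bullet> D' s)) - 2 * L * exp (- 2 * L * s) * (D s \<bullet> D s) \<le> 0"
        by (simp add: mult.assoc mult.left_commute)
      ultimately show "\<exists>y. (V has_real_derivative y) (at s) \<and> y \<le> 0"
        by blast
    qed
    then have "D t \<bullet> D t \<le> 0"
      using \<open>D 0 = 0\<close> by (simp add: V_def mult_le_0_iff)
    then show ?thesis
      by (metis inner_eq_zero_iff inner_ge_zero order_antisym)
  qed
  show ?thesis
  proof (cases "0 \<le> t")
    case True
    then show ?thesis
      using assms by (intro pos[of t D D']) (auto simp: closed_segment_eq_real_ivl)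
  next
    case False
    have "D (- (- t)) = 0"
    proof (rule pos[of "- t" "\<lambda>s. D (- s)" "\<lambda>s. - D' (- s)"])
      fix s assume "s \<in> {0..- t}"
      then have "- s \<in> closed_segment 0 t"
        using False by (auto simp: closed_segment_eq_real_ivl)
      then show "((\<lambda>s. D (- s)) has_vector_derivative - D' (- s)) (at s)"
        and "norm (- D' (- s)) \<le> L * norm (D (- s))"
        using has_vector_derivative_reflect[OF deriv] bound by auto
    qed (use False \<open>D 0 = 0\<close> in auto)
    then show ?thesis by simp
  qed
qed

lemma deriv_exp_bound:
  fixes D :: "real \<Rightarrow> 'a::real_normed_vector"
  assumes "K > 0" "D 0 = 0"
    and deriv: "\<And>s. (D has_vector_derivative D' s) (at s)"
    and bound: "\<And>s. norm (D' s) \<le> c * exp (K * \<bar>s\<bar>)"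
  shows "norm (D t) \<le> c / K * exp (K * \<bar>t\<bar>)"
proof -
  have "0 \<le> c"
    using order_trans[OF norm_ge_zero bound[of 0]] by simp
  have pos: "norm (D t) \<le> c / K * exp (K * t)"
    if "t \<ge> 0" "D 0 = 0" and deriv: "\<And>s. (D has_vector_derivative D' s) (at s)"
      and bound: "\<And>s. norm (D' s) \<le> c * exp (K * \<bar>s\<bar>)"
    for t and D D' :: "real \<Rightarrow> 'a"
  proof (cases "t = 0")
    case True
    then show ?thesis
      using \<open>0 \<le> c\<close> \<open>K > 0\<close> \<open>D 0 = 0\<close> by simp
  next
    case False
    with \<open>t \<ge> 0\<close> have "0 < t" by simp
    have "norm (D t - D 0) \<le> c / K * exp (K * t) - c / K * exp (K * 0)"
    proof (rule differentiable_bound_general[OF \<open>0 < t\<close>])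
      show "continuous_on {0..t} D"
        using deriv by (intro continuous_at_imp_continuous_on ballI has_vector_derivative_continuous)
      show "continuous_on {0..t} (\<lambda>s. c / K * exp (K * s))"
        by (intro continuous_intros)
      fix s assume "0 < s" "s < t"
      then show "norm (D' s) \<le> c * exp (K * s)"
        using bound[of s] by simp
      show "((\<lambda>s. c / K * exp (K * s)) has_vector_derivative c * exp (K * s)) (at s)"
        unfolding has_real_derivative_iff_has_vector_derivative[symmetric]
        using \<open>K > 0\<close> by (auto intro!: derivative_eq_intros)
    qed (rule deriv)
    moreover have "0 \<le> c / K"
      using \<open>0 \<le> c\<close> \<open>K > 0\<close> by simp
    ultimately show ?thesis
      using \<open>D 0 = 0\<close> by simp
  qed
  show ?thesis
  proof (cases "t \<ge> 0")
    case True
    then show ?thesis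
      using pos[of t D D'] assms by simp
  next
    case False
    have "norm (D (- (- t))) \<le> c / K * exp (K * (- t))"
    proof (rule pos)
      show "((\<lambda>s. D (- s)) has_vector_derivative - D' (- s)) (at s)" for s
        by (rule has_vector_derivative_reflect[OF deriv])
      show "norm (- D' (- s)) \<le> c * exp (K * \<bar>s\<bar>)" for s
        using bound[of "- s"] by simp
    qed (use False \<open>D 0 = 0\<close> in auto)
    then show ?thesis
      using False by simp
  qed
qed

lemma antiderivative_exists:
  fixes g :: "real \<Rightarrow> 'a::euclidean_space"
  assumes "continuous_on UNIV g"
  shows "\<exists>G. G 0 = 0 \<and> (\<forall>t. (G has_vector_derivative g t) (at t))"
proof (intro exI[of _ "\<lambda>u. LBINT s=ereal 0..ereal u. g s"] conjI allI)
  fix t :: real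
  let ?a = "- \<bar>t\<bar> - 1" and ?b = "\<bar>t\<bar> + 1"
  have "((\<lambda>u. LBINT s=ereal 0..ereal u. g s) has_vector_derivative g t) (at t within {?a..?b})"
    by (rule interval_integral_FTC2) (use assms in \<open>auto intro: continuous_on_subset\<close>)
  moreover have "t \<in> interior {?a..?b}"
    by (auto simp: abs_if)
  ultimately show "((\<lambda>u. LBINT s=ereal 0..ereal u. g s) has_vector_derivative g t) (at t)"
    by (simp only: at_within_interior)
qed simp

lemma global_solution_exists:
  fixes F :: "real \<Rightarrow> 'a::euclidean_space \<Rightarrow> 'a"
  assumes cont: "\<And>u. continuous_on UNIV u \<Longrightarrow> continuous_on UNIV (\<lambda>t. F t (u t))"
    and lip: "\<And>t x y. norm (F t x - F t y) \<le> L * norm (x - y)"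
    and bound: "\<And>t. norm (F t 0) \<le> C"
  shows "\<exists>u. u 0 = x0 \<and> (\<forall>t. (u has_vector_derivative F t (u t)) (at t))"
proof -
  define K where "K = 2 * (\<bar>L\<bar> + 1)"
  have "K > 0"
    by (simp add: K_def)
  have "0 \<le> C"
    using order_trans[OF norm_ge_zero bound] .
  have lip: "norm (F t x - F t y) \<le> \<bar>L\<bar> * norm (x - y)" for t x y
    using lip[of t x y] by (rule order_trans) (intro mult_right_mono, auto)
  \<comment> \<open>the Picard operator is a contraction in the weighted sup norm with weight \<open>exp (- K * \<bar>t\<bar>)\<close>\<close>
  define E where "E t = exp (K * \<bar>t\<bar>)" for t
  have E: "E t > 0" "E t \<ge> 1" "continuous_on UNIV E" for t
    using \<open>K > 0\<close> unfolding E_def by (auto intro!: continuous_intros)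
  have "\<forall>v :: real \<Rightarrow>\<^sub>C 'a. \<exists>G. G 0 = 0 \<and> (\<forall>t. (G has_vector_derivative F t (E t *\<^sub>R v t)) (at t))"
    by (intro allI antiderivative_exists cont continuous_intros E) auto
  then obtain J :: "(real \<Rightarrow>\<^sub>C 'a) \<Rightarrow> real \<Rightarrow> 'a" where J0: "\<And>v. J v 0 = 0"
    and J: "\<And>v t. (J v has_vector_derivative F t (E t *\<^sub>R v t)) (at t)"
    by metis
  have J_cont: "continuous_on UNIV (J v)" for v
    using J by (intro continuous_at_imp_continuous_on ballI has_vector_derivative_continuous)
  have J_bound: "norm (J v t) \<le> (C + \<bar>L\<bar> * norm v) / K * E t" for v t
    unfolding E_def
  proof (rule deriv_exp_bound[OF \<open>K > 0\<close> J0 J])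
    fix s
    have "norm (F s (E s *\<^sub>R v s)) \<le> norm (F s 0) + norm (F s (E s *\<^sub>R v s) - F s 0)"
      by (rule norm_triangle_sub)
    also have "\<dots> \<le> C + \<bar>L\<bar> * (E s * norm v)"
      using lip[of s "E s *\<^sub>R v s" 0] E(1)[of s] norm_bounded[of v s]
      by (intro add_mono bound) (auto elim!: order_trans intro!: mult_left_mono)
    also have "\<dots> \<le> (C + \<bar>L\<bar> * norm v) * E s"
      using E(2)[of s] mult_left_mono[OF E(2)[of s] \<open>0 \<le> C\<close>] by (simp add: algebra_simps)
    finally show "norm (F s (E s *\<^sub>R v s)) \<le> (C + \<bar>L\<bar> * norm v) * exp (K * \<bar>s\<bar>)"
      by (simp add: E_def)
  qed
  have J_diff: "norm (J v t - J w t) \<le> \<bar>L\<bar> * dist v w / K * E t" for v w t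
    unfolding E_def
  proof (rule deriv_exp_bound[OF \<open>K > 0\<close>])
    show "((\<lambda>t. J v t - J w t) has_vector_derivative F s (E s *\<^sub>R v s) - F s (E s *\<^sub>R w s)) (at s)" for s
      by (rule has_vector_derivative_diff[OF J J])
    fix s
    have "norm (F s (E s *\<^sub>R v s) - F s (E s *\<^sub>R w s)) \<le> \<bar>L\<bar> * norm (E s *\<^sub>R (v s - w s))"
      using lip[of s "E s *\<^sub>R v s" "E s *\<^sub>R w s"] by (simp add: scaleR_diff_right)
    also have "\<dots> \<le> \<bar>L\<bar> * (E s * dist v w)"
      using E(1)[of s] dist_bounded[of v s w] by (intro mult_left_mono) (auto simp: dist_norm)
    finally show "norm (F s (E s *\<^sub>R v s) - F s (E s *\<^sub>R w s)) \<le> \<bar>L\<bar> * dist v w * exp (K * \<bar>s\<bar>)"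
      by (simp add: E_def algebra_simps)
  qed (simp add: J0)
  define \<Psi> where "\<Psi> v t = (x0 + J v t) /\<^sub>R E t" for v t
  have \<Psi>: "\<Psi> v \<in> bcontfun" for v
  proof (rule bcontfun_normI)
    show "continuous_on UNIV (\<Psi> v)"
      unfolding \<Psi>_def using E by (intro continuous_intros J_cont) (auto simp: less_imp_neq[OF E(1), symmetric])
    fix t
    have "norm (x0 + J v t) \<le> norm x0 * E t + (C + \<bar>L\<bar> * norm v) / K * E t"
      using J_bound[of v t] mult_left_mono[OF E(2)[of t] norm_ge_zero[of x0]]
      by (intro norm_triangle_le add_mono) auto
    then have "norm (x0 + J v t) \<le> (norm x0 + (C + \<bar>L\<bar> * norm v) / K) * E t"
      by (simp only: distrib_right)
    then show "norm (\<Psi> v t) \<le> norm x0 + (C + \<bar>L\<bar> * norm v) / K"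
      using E(1)[of t] by (simp add: \<Psi>_def pos_divide_le_eq[symmetric] divide_inverse_commute)
  qed
  have "\<exists>!v. Bcontfun (\<Psi> v) = v"
  proof (rule banach_fix_type[of "1/2"], simp, simp, intro allI)
    fix v w
    show "dist (Bcontfun (\<Psi> v)) (Bcontfun (\<Psi> w)) \<le> 1/2 * dist v w"
    proof (rule dist_bound)
      fix t
      have "\<Psi> v t - \<Psi> w t = (J v t - J w t) /\<^sub>R E t"
        by (simp add: \<Psi>_def scaleR_add_right scaleR_diff_right)
      then have \<Psi>_diff: "norm (\<Psi> v t - \<Psi> w t) = norm (J v t - J w t) / E t"
        using E(1)[of t] by (simp add: divide_inverse_commute)
      have "norm (J v t - J w t) / E t \<le> \<bar>L\<bar> / K * dist v w"
        using J_diff[of v t w] E(1)[of t] \<open>K > 0\<close> by (simp add: pos_divide_le_eq ac_simps)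
      also have "\<dots> \<le> 1/2 * dist v w"
        by (intro mult_right_mono) (auto simp: K_def divide_simps)
      finally show "dist (Bcontfun (\<Psi> v) t) (Bcontfun (\<Psi> w) t) \<le> 1/2 * dist v w"
        by (simp only: Bcontfun_inverse[OF \<Psi>] dist_norm \<Psi>_diff)
    qed
  qed
  then obtain v where v: "Bcontfun (\<Psi> v) = v"
    by blast
  define u where "u t = x0 + J v t" for t
  have "v t = u t /\<^sub>R E t" for t
    using fun_cong[OF Bcontfun_inverse[OF \<Psi>, of v], of t] unfolding v by (simp add: \<Psi>_def u_def)
  then have "E t *\<^sub>R v t = u t" for t
    using E(1)[of t] by simp
  then have "(u has_vector_derivative F t (u t)) (at t)" for t
    using J[of v t] unfolding u_def by (auto intro!: derivative_eq_intros)
  moreover have "u 0 = x0"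
    by (simp add: u_def J0)
  ultimately show ?thesis
    by blast
qed

lemma local_lipschitz_on_compact:
  fixes f :: "'a::metric_space \<Rightarrow> 'b::metric_space"
  assumes "local_lipschitz (UNIV :: real set) UNIV (\<lambda>_. f)" "compact X"
  obtains L where "L-lipschitz_on X f"
proof (rule local_lipschitz_compact_implies_lipschitz[of "{0::real}" X "\<lambda>_. f"])
  show "local_lipschitz {0::real} X (\<lambda>_. f)"
    using assms(1) by (rule local_lipschitz_subset) auto
  show "\<And>L. (\<And>t::real. t \<in> {0} \<Longrightarrow> L-lipschitz_on X f) \<Longrightarrow> thesis"
    using that by blast
qed (use assms(2) in auto)

lemma solution_segment:
  assumes "solution g S x I \<phi>" "t \<in> I"
  shows "closed_segment 0 t \<subseteq> I"
proof (rule closed_segment_subset)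
  show "convex I"
    using assms(1) is_interval_convex_1 by (auto simp: solution_def)
qed (use assms in \<open>auto simp: solution_def\<close>)

lemma solution_continuous_on:
  assumes "solution g S x I \<phi>"
  shows "continuous_on I \<phi>"
proof (intro continuous_at_imp_continuous_on ballI)
  fix t assume "t \<in> I"
  with assms have "(\<phi> has_vector_derivative g (\<phi> t)) (at t)"
    by (simp add: solution_def)
  then show "isCont \<phi> t"
    by (rule has_vector_derivative_continuous)
qed

lemma solution_mono: "solution g S x I \<phi> \<Longrightarrow> S \<subseteq> S' \<Longrightarrow> solution g S' x I \<phi>"
  unfolding solution_def by blast

lemma solution_cong:
  assumes "solution g S x I \<phi>" "\<And>t. t \<in> I \<Longrightarrow> \<psi> t = \<phi> t"
  shows "solution g S x I \<psi>"
  unfolding solution_def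
proof (intro conjI ballI)
  fix t assume "t \<in> I"
  with assms show "\<psi> t \<in> S"
    by (simp add: solution_def)
  show "(\<psi> has_vector_derivative g (\<psi> t)) (at t)"
    using assms \<open>t \<in> I\<close>
    by (intro has_vector_derivative_transform_within_open[of \<phi> "g (\<psi> t)" t I \<psi>]) (auto simp: solution_def)
qed (use assms in \<open>auto simp: solution_def\<close>)

lemma solutions_agree:
  fixes f :: "'a::real_inner \<Rightarrow> 'a"
  assumes f: "local_lipschitz (UNIV :: real set) UNIV (\<lambda>_. f)"
    and \<phi>: "solution f S x I \<phi>" and \<psi>: "solution f S' x J \<psi>" and t: "t \<in> I" "t \<in> J"
  shows "\<phi> t = \<psi> t"
proof -
  let ?X = "\<phi> ` closed_segment 0 t \<union> \<psi> ` closed_segment 0 t"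
  have sub: "closed_segment 0 t \<subseteq> I" "closed_segment 0 t \<subseteq> J"
    using solution_segment[OF \<phi>] solution_segment[OF \<psi>] t by auto
  have "compact ?X"
    using sub solution_continuous_on[OF \<phi>] solution_continuous_on[OF \<psi>]
    by (intro compact_Un compact_continuous_image compact_segment) (auto intro: continuous_on_subset)
  with f obtain L where L: "L-lipschitz_on ?X f"
    by (rule local_lipschitz_on_compact)
  have "\<phi> t - \<psi> t = 0"
  proof (rule deriv_bound_imp_zero[where D = "\<lambda>s. \<phi> s - \<psi> s"])
    show "\<phi> 0 - \<psi> 0 = 0"
      using \<phi> \<psi> by (simp add: solution_def)
    fix s assume s: "s \<in> closed_segment 0 t"
    then show "((\<lambda>s. \<phi> s - \<psi> s) has_vector_derivative f (\<phi> s) - f (\<psi> s)) (at s)"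
      using \<phi> \<psi> sub unfolding solution_def by (intro has_vector_derivative_diff) auto
    show "norm (f (\<phi> s) - f (\<psi> s)) \<le> L * norm (\<phi> s - \<psi> s)"
      using s by (intro lipschitz_on_normD[OF L]) auto
  qed
  then show ?thesis by simp
qed

lemma unique_maximal_solution_exists:
  assumes agree: "\<forall>I \<phi> J \<psi>. solution g S x I \<phi> \<longrightarrow> solution g S x J \<psi> \<longrightarrow> (\<forall>t\<in>I \<inter> J. \<phi> t = \<psi> t)"
    and "solution g S x I0 \<phi>0"
  shows "\<exists>I \<phi>. unique_maximal_solution g S x I \<phi> \<and>
    (\<forall>J \<psi>. solution g S x J \<psi> \<longrightarrow> J \<subseteq> I \<and> (\<forall>t\<in>J. \<psi> t = \<phi> t))"
proof -
  define I where "I = \<Union>{J. \<exists>\<psi>. solution g S x J \<psi>}"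
  define \<phi> where "\<phi> t = (SOME y. \<exists>J \<psi>. solution g S x J \<psi> \<and> t \<in> J \<and> y = \<psi> t)" for t
  have ext: "J \<subseteq> I \<and> (\<forall>t\<in>J. \<psi> t = \<phi> t)" if "solution g S x J \<psi>" for J \<psi>
  proof (intro conjI ballI)
    show "J \<subseteq> I"
      using that by (auto simp: I_def)
    fix t assume "t \<in> J"
    with that have "\<exists>y J \<psi>. solution g S x J \<psi> \<and> t \<in> J \<and> y = \<psi> t"
      by blast
    then have "\<exists>J \<psi>. solution g S x J \<psi> \<and> t \<in> J \<and> \<phi> t = \<psi> t"
      unfolding \<phi>_def by (rule someI_ex)
    with agree that \<open>t \<in> J\<close> show "\<psi> t = \<phi> t"
      by (metis IntI)
  qed
  have "solution g S x I \<phi>"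
    unfolding solution_def
  proof (intro conjI ballI)
    show "open I"
      unfolding I_def by (rule open_Union) (auto simp: solution_def)
    have "connected I"
      unfolding I_def
      by (rule connected_Union) (auto simp: solution_def is_interval_connected_1)
    then show "is_interval I"
      by (simp add: is_interval_connected_1)
    show "0 \<in> I" "\<phi> 0 = x"
      using ext[OF assms(2)] assms(2) by (auto simp: solution_def)
    fix t assume "t \<in> I"
    then obtain J \<psi> where J: "solution g S x J \<psi>" "t \<in> J"
      by (auto simp: I_def)
    then have "solution g S x J \<phi>"
      using ext[OF J(1)] by (intro solution_cong[OF J(1)]) simp
    with J show "\<phi> t \<in> S" "(\<phi> has_vector_derivative g (\<phi> t)) (at t)"
      by (auto simp: solution_def)
  qed
  then have "maximal_solution g S x I \<phi>"
    using ext unfolding maximal_solution_def by blast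
  moreover have "J = I \<and> (\<forall>t\<in>I. \<psi> t = \<phi> t)" if "maximal_solution g S x J \<psi>" for J \<psi>
  proof -
    have J: "solution g S x J \<psi>"
      using that by (simp add: maximal_solution_def)
    with \<open>solution g S x I \<phi>\<close> ext[OF J] have "I = J"
      using that unfolding maximal_solution_def by metis
    then show ?thesis
      using ext[OF J] by simp
  qed
  ultimately show ?thesis
    using ext unfolding unique_maximal_solution_def by blast
qed

lemma solution_exists:
  fixes f :: "'a::euclidean_space \<Rightarrow> 'a"
  assumes f: "local_lipschitz (UNIV :: real set) UNIV (\<lambda>_. f)" and "open S" "x \<in> S"
  shows "\<exists>I \<phi>. solution f S x I \<phi>"
proof -
  obtain r where "r > 0" and r: "cball x r \<subseteq> S"
    using assms(2,3) open_contains_cball by blast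
  obtain L where L: "L-lipschitz_on (cball x r) f"
    using f compact_cball by (rule local_lipschitz_on_compact)
  let ?p = "closest_point (cball x r)"
  have p: "?p y \<in> cball x r" for y
    using \<open>r > 0\<close> by (intro closest_point_in_set) auto
  have "\<exists>u. u 0 = x \<and> (\<forall>t. (u has_vector_derivative f (?p (u t))) (at t))"
  proof (rule global_solution_exists)
    show "continuous_on UNIV (\<lambda>t. f (?p (u t)))" if "continuous_on UNIV u" for u
    proof (rule continuous_on_compose2[OF lipschitz_on_continuous_on[OF L]])
      show "continuous_on UNIV (\<lambda>t. ?p (u t))"
        using \<open>r > 0\<close> that
        by (intro continuous_on_compose2[OF continuous_on_closest_point that, of "cball x r" UNIV]) auto
    qed (use p in auto)
    show "norm (f (?p y) - f (?p z)) \<le> L * norm (y - z)" for y z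
    proof -
      have "norm (f (?p y) - f (?p z)) \<le> L * norm (?p y - ?p z)"
        by (rule lipschitz_on_normD[OF L p p])
      also have "\<dots> \<le> L * norm (y - z)"
        using closest_point_lipschitz[of "cball x r" y z] \<open>r > 0\<close> lipschitz_on_nonneg[OF L]
        by (intro mult_left_mono) (auto simp: dist_norm)
      finally show ?thesis .
    qed
  qed (rule order_refl)
  then obtain u where u: "u 0 = x" "\<And>t. (u has_vector_derivative f (?p (u t))) (at t)"
    by blast
  then have "isCont u 0"
    by (blast intro: has_vector_derivative_continuous)
  with \<open>r > 0\<close> u(1) obtain \<delta> where "\<delta> > 0" and \<delta>: "\<And>t. \<bar>t\<bar> < \<delta> \<Longrightarrow> dist (u t) x < r"
    by (auto simp: continuous_at_eps_delta dist_real_def)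
  have "solution f S x {- \<delta><..<\<delta>} u"
    unfolding solution_def
  proof (intro conjI ballI)
    fix t assume "t \<in> {- \<delta><..<\<delta>}"
    then have "u t \<in> cball x r"
      using \<delta>[of t] by (auto simp: dist_commute intro: less_imp_le)
    then show "u t \<in> S" "(u has_vector_derivative f (u t)) (at t)"
      using r u(2)[of t] by (auto simp: closest_point_self)
  qed (use \<open>\<delta> > 0\<close> u(1) in \<open>auto simp: is_interval_oo\<close>)
  then show ?thesis
    by blast
qed

lemma local_lipschitz_maximal_solution:
  fixes f :: "'a::euclidean_space \<Rightarrow> 'a"
  assumes f: "local_lipschitz (UNIV :: real set) UNIV (\<lambda>_. f)" and "open S" "x \<in> S"
  shows "\<exists>\<phi>. maximal_solution f S x (max_interval f S x) \<phi> \<and>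
    (\<forall>J \<psi>. solution f S x J \<psi> \<longrightarrow> J \<subseteq> max_interval f S x \<and> (\<forall>t\<in>J. \<psi> t = \<phi> t))"
proof -
  obtain I0 \<phi>0 where sol: "solution f S x I0 \<phi>0"
    using solution_exists[OF assms] by blast
  have "\<forall>I \<phi> J \<psi>. solution f S x I \<phi> \<longrightarrow> solution f S x J \<psi> \<longrightarrow> (\<forall>t\<in>I \<inter> J. \<phi> t = \<psi> t)"
    by (intro allI impI ballI, erule IntE) (rule solutions_agree[OF f])
  from unique_maximal_solution_exists[OF this sol] obtain I \<phi>
    where I: "unique_maximal_solution f S x I \<phi>"
      and ext: "\<forall>J \<psi>. solution f S x J \<psi> \<longrightarrow> J \<subseteq> I \<and> (\<forall>t\<in>J. \<psi> t = \<phi> t)"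
    by blast
  have "max_interval f S x = I"
    unfolding max_interval_def
    by (rule the_equality) (use I in \<open>auto simp: unique_maximal_solution_def\<close>)
  with I ext show ?thesis
    by (intro exI[of _ \<phi>]) (simp add: unique_maximal_solution_def)
qed

lemma
  fixes f :: "'a::euclidean_space \<Rightarrow> 'a"
  assumes f: "local_lipschitz (UNIV :: real set) UNIV (\<lambda>_. f)"
  shows solution_flow: "solution f UNIV x (max_interval f UNIV x) (flow f x)"
    and solution_imp_flow:
      "solution f S x J \<psi> \<Longrightarrow> J \<subseteq> max_interval f UNIV x \<and> (\<forall>t\<in>J. \<psi> t = flow f x t)"
proof -
  from local_lipschitz_maximal_solution[OF f open_UNIV UNIV_I] obtain \<phi>
    where \<phi>: "maximal_solution f UNIV x (max_interval f UNIV x) \<phi>"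
      and ext: "\<And>J \<psi>. solution f UNIV x J \<psi> \<Longrightarrow> J \<subseteq> max_interval f UNIV x \<and> (\<forall>t\<in>J. \<psi> t = \<phi> t)"
    by blast
  have flow: "flow f x t = \<phi> t" if "t \<in> max_interval f UNIV x" for t
    unfolding flow_def
    by (rule the_equality) (use \<phi> ext that in \<open>auto simp: maximal_solution_def\<close>)
  show "solution f UNIV x (max_interval f UNIV x) (flow f x)"
    using \<phi> flow by (auto simp: maximal_solution_def intro: solution_cong)
  show "J \<subseteq> max_interval f UNIV x \<and> (\<forall>t\<in>J. \<psi> t = flow f x t)" if "solution f S x J \<psi>"
    using ext[OF solution_mono[OF that]] flow by auto
qed

lemma flow_add:
  fixes f :: "'a::euclidean_space \<Rightarrow> 'a"
  assumes f: "local_lipschitz (UNIV :: real set) UNIV (\<lambda>_. f)"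
    and t: "t \<in> max_interval f UNIV x" "t + s \<in> max_interval f UNIV x"
  shows "flow f (flow f x t) s = flow f x (t + s)"
proof -
  let ?I = "max_interval f UNIV x"
  have sol: "solution f UNIV x ?I (flow f x)"
    by (rule solution_flow[OF f])
  have eq: "(+) (- t) ` ?I = {s. t + s \<in> ?I}"
    by (auto simp: image_iff) (metis add_diff_cancel_left')
  have "solution f UNIV (flow f x t) {s. t + s \<in> ?I} (\<lambda>s. flow f x (t + s))"
    unfolding solution_def
  proof (intro conjI ballI)
    show "open {s. t + s \<in> ?I}"
      unfolding eq[symmetric] using sol by (intro open_translation) (auto simp: solution_def)
    show "is_interval {s. t + s \<in> ?I}"
      unfolding eq[symmetric] using sol by (auto simp: solution_def)
    fix s assume "s \<in> {s. t + s \<in> ?I}"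
    then have "(flow f x has_vector_derivative f (flow f x (t + s))) (at (t + s))"
      using sol by (auto simp: solution_def)
    moreover have "((+) t has_vector_derivative 1) (at s)"
      by (auto intro!: derivative_eq_intros)
    ultimately show "((\<lambda>s. flow f x (t + s)) has_vector_derivative f (flow f x (t + s))) (at s)"
      using vector_diff_chain_at[of "(+) t" 1 s "flow f x"] by (simp add: o_def)
  qed (use t in auto)
  from solution_imp_flow[OF f this] show ?thesis
    using t by auto
qed

section \<open>Decay of linear systems with a Hurwitz matrix\<close>

lemma linear_relation_exists:
  fixes f :: "nat \<Rightarrow> 'a::euclidean_space"
  obtains c :: "nat \<Rightarrow> real" and N i where "i \<le> N" "c i \<noteq> 0" "(\<Sum>k\<le>N. c k *\<^sub>R f k) = 0"
proof (cases "inj f")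
  case False
  then obtain i j where ij: "f i = f j" "i \<noteq> j"
    by (auto simp: inj_on_def)
  define c :: "nat \<Rightarrow> real" where "c k = (if k = i then 1 else 0) - (if k = j then 1 else 0)" for k
  have "(\<Sum>k\<le>i+j. c k *\<^sub>R f k)
      = (\<Sum>k\<le>i+j. if k = i then f k else 0) - (\<Sum>k\<le>i+j. if k = j then f k else 0)"
    unfolding sum_subtractf[symmetric] by (rule sum.cong) (auto simp: c_def ij)
  also have "\<dots> = 0"
    using ij by simp
  finally show thesis
    using that[of i "i + j" c] ij by (auto simp: c_def)
next
  case True
  define N where "N = DIM('a)"
  have inj: "inj_on f {..N}"
    using True by (rule inj_on_subset) auto
  have "dependent (f ` {..N})"
    by (rule dependent_biggerset) (use card_image[OF inj] in \<open>simp add: N_def\<close>)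
  then obtain u where u: "(\<exists>v\<in>f ` {..N}. u v \<noteq> 0)" "(\<Sum>v\<in>f ` {..N}. u v *\<^sub>R v) = 0"
    by (auto simp: dependent_finite)
  then obtain i where "i \<le> N" "u (f i) \<noteq> 0"
    by auto
  moreover have "(\<Sum>k\<le>N. u (f k) *\<^sub>R f k) = 0"
    using u(2) by (simp add: sum.reindex[OF inj])
  ultimately show thesis
    using that[of i N "u \<circ> f"] by auto
qed

definition poly_apply :: "'a::field^'m^'m \<Rightarrow> 'a poly \<Rightarrow> 'a^'m \<Rightarrow> 'a^'m"
  where "poly_apply A p v = (\<Sum>i\<le>degree p. coeff p i *s (((*v) A ^^ i) v))"

lemma poly_apply_eq:
  assumes "degree p \<le> N"
  shows "poly_apply A p v = (\<Sum>i\<le>N. coeff p i *s (((*v) A ^^ i) v))"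
  unfolding poly_apply_def
  by (rule sum.mono_neutral_left) (use assms in \<open>auto simp: coeff_eq_0\<close>)

lemma poly_apply_linear_factor:
  "poly_apply A ([:- a, 1:] * q) v = A *v poly_apply A q v - a *s poly_apply A q v"
proof -
  define N where "N = degree q"
  define w where "w i = ((*v) A ^^ i) v" for i
  have w: "A *v w i = w (Suc i)" for i
    by (simp add: w_def)
  have deg: "degree ([:- a, 1:] * q) \<le> Suc N"
    using degree_mult_le[of "[:- a, 1:]" q] by (auto simp: N_def)
  have "poly_apply A ([:- a, 1:] * q) v
      = (\<Sum>i\<le>Suc N. coeff (pCons 0 q) i *s w i) - (\<Sum>i\<le>Suc N. (a * coeff q i) *s w i)"
    unfolding poly_apply_eq[OF deg] sum_subtractf[symmetric] w_def[symmetric]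
    by (intro sum.cong refl) (simp add: vector_sub_rdistrib)
  also have "(\<Sum>i\<le>Suc N. coeff (pCons 0 q) i *s w i) = A *v poly_apply A q v"
    unfolding poly_apply_def
    by (subst sum.atMost_Suc_shift)
       (simp add: N_def w_def matrix_vector_mult_def vec_eq_iff sum_distrib_left sum_component algebra_simps
         sum.swap[where A = UNIV])
  also have "(\<Sum>i\<le>Suc N. (a * coeff q i) *s w i) = a *s poly_apply A q v"
    by (simp add: poly_apply_def N_def w_def coeff_eq_0 vec_eq_iff sum_distrib_left sum_component algebra_simps)
  finally show ?thesis .
qed

definition shifts :: "'a::field^'m^'m \<Rightarrow> 'a list \<Rightarrow> 'a^'m \<Rightarrow> 'a^'m"
  where "shifts A = foldr (\<lambda>a v. A *v v - a *s v)"

lemma shifts_Nil [simp]: "shifts A [] v = v"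
  and shifts_Cons [simp]: "shifts A (a # as) v = A *v shifts A as v - a *s shifts A as v"
  by (simp_all add: shifts_def)

lemma shifts_shift: "shifts A as (A *v v - a *s v) = A *v shifts A as v - a *s shifts A as v"
proof (induction as)
  case (Cons b as)
  show ?case
    unfolding shifts_Cons Cons
    by (simp add: matrix_vector_mult_diff_distrib vector_ssub_ldistrib
        vector_scalar_commute[symmetric] vector_smult_assoc mult.commute)
qed simp

lemma shifts_swap: "shifts A (as @ a # bs) v = shifts A (a # as @ bs) v"
proof -
  have "shifts A (as @ bs) v = shifts A as (shifts A bs v)" for as bs
    by (simp add: shifts_def)
  then show ?thesis
    by (simp add: shifts_shift)
qed

lemma shifts_matrix: "shifts A as (A *v v) = A *v shifts A as v"
  by (induction as) (simp_all add: matrix_vector_mult_diff_distrib vector_scalar_commute[symmetric])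

lemma poly_apply_factorization:
  fixes A :: "complex^'m^'m"
  assumes "p \<noteq> 0"
  shows "\<exists>c as. c \<noteq> 0 \<and> (\<forall>v. poly_apply A p v = c *s shifts A as v)"
  using assms
proof (induction "degree p" arbitrary: p)
  case 0
  then show ?case
    by (intro exI[of _ "coeff p 0"] exI[of _ "[]"]) (use leading_coeff_0_iff[of p] in \<open>auto simp: poly_apply_def simp del: leading_coeff_0_iff\<close>)
next
  case (Suc n)
  have "\<not> constant (poly p)"
    using Suc.hyps(2) by (simp add: constant_degree)
  then obtain a where "poly p a = 0"
    using fundamental_theorem_of_algebra by blast
  then obtain q where q: "p = [:- a, 1:] * q"
    by (auto simp: poly_eq_0_iff_dvd dvd_def)
  then have "q \<noteq> 0"
    using Suc.prems by auto
  then have "n = degree q"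
    using Suc.hyps(2) unfolding q by (subst (asm) degree_mult_eq) auto
  with Suc.hyps(1) \<open>q \<noteq> 0\<close> obtain c as where
    "c \<noteq> 0" "\<forall>v. poly_apply A q v = c *s shifts A as v"
    by blast
  then have "\<forall>v. poly_apply A p v = c *s shifts A (a # as) v"
    unfolding q by (simp only: poly_apply_linear_factor shifts_Cons)
      (simp add: vector_scalar_commute[symmetric] vector_ssub_ldistrib vector_smult_assoc mult.commute)
  with \<open>c \<noteq> 0\<close> show ?case
    by blast
qed

lemma scalar_mult_of_real:
  "complex_of_real r *s (M *v v) = (r *\<^sub>R M) *v v"
  by (simp add: vec_eq_iff matrix_vector_mult_def sum_distrib_left mult.assoc scaleR_conv_of_real[of _ "x :: complex" for x])

lemma shifts_annihilate:
  fixes A :: "complex^'m^'m"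
  shows "\<exists>as. \<forall>v. shifts A as v = 0"
proof -
  define P where "P i = ((**) A ^^ i) (mat 1)" for i
  have P: "P i *v v = ((*v) A ^^ i) v" for i v
    by (induction i) (simp_all add: P_def matrix_vector_mul_assoc[symmetric])
  obtain c :: "nat \<Rightarrow> real" and N i where c: "i \<le> N" "c i \<noteq> 0" "(\<Sum>k\<le>N. c k *\<^sub>R P k) = 0"
    by (rule linear_relation_exists)
  define p where "p = (\<Sum>k\<le>N. monom (complex_of_real (c k)) k)"
  have coeff: "coeff p k = (if k \<le> N then complex_of_real (c k) else 0)" for k
    by (simp add: p_def coeff_sum)
  have "poly_apply A p v = 0" for v
  proof -
    have "degree p \<le> N"
      by (rule degree_le) (simp add: coeff)
    then have "poly_apply A p v = (\<Sum>k\<le>N. complex_of_real (c k) *s (P k *v v))"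
      by (simp add: poly_apply_eq coeff P)
    also have "\<dots> = (\<Sum>k\<le>N. c k *\<^sub>R P k) *v v"
      by (induction N)
        (simp_all add: matrix_vector_mult_add_rdistrib scaleR_matrix_vector_assoc scalar_mult_of_real)
    finally show ?thesis
      using c(3) by simp
  qed
  moreover have "p \<noteq> 0"
    using c(1,2) coeff[of i] by auto
  ultimately obtain c' as where "c' \<noteq> 0" "\<forall>v. c' *s shifts A as v = 0"
    using poly_apply_factorization[of p A] by auto
  then show ?thesis
    by (auto simp: vec.scale_eq_0_iff)
qed

lemma eigenvalue_shifts_annihilate:
  fixes A :: "complex^'m^'m"
  obtains as where "\<And>v. shifts A as v = 0"
    and "\<And>a. a \<in> set as \<Longrightarrow> \<exists>v. v \<noteq> 0 \<and> A *v v = a *s v"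
proof -
  define as where "as = (ARG_MIN length as. \<forall>v. shifts A as v = 0)"
  have 0: "\<forall>v. shifts A as v = 0" and min: "\<And>bs. \<forall>v. shifts A bs v = 0 \<Longrightarrow> length as \<le> length bs"
    using arg_min_nat_lemma[of "\<lambda>as. \<forall>v. shifts A as v = 0", OF someI_ex[OF shifts_annihilate], of length]
    by (auto simp: as_def)
  have "\<exists>v. v \<noteq> 0 \<and> A *v v = a *s v" if "a \<in> set as" for a
  proof (rule ccontr)
    assume "\<not> ?thesis"
    then have inj: "v = 0" if "A *v v - a *s v = 0" for v
      using that by (metis eq_iff_diff_eq_0)
    obtain bs cs where "as = bs @ a # cs"
      using \<open>a \<in> set as\<close> by (meson split_list)
    with 0 have "shifts A (bs @ cs) v = 0" for v
      using inj by (simp add: shifts_swap)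
    then have "length as \<le> length (bs @ cs)"
      using min by blast
    with \<open>as = bs @ a # cs\<close> show False
      by simp
  qed
  with 0 that show thesis
    by blast
qed

lemma perturbed_decay:
  fixes u w :: "real \<Rightarrow> complex"
  assumes "Re c < 0"
    and u: "\<And>t. 0 \<le> t \<Longrightarrow> (u has_vector_derivative c * u t + w t) (at t)"
    and w: "(w \<longlongrightarrow> 0) at_top"
  shows "(u \<longlongrightarrow> 0) at_top"
proof (rule tendstoI)
  fix \<epsilon> :: real assume "\<epsilon> > 0"
  define \<mu> where "\<mu> = - Re c"
  have "\<mu> > 0"
    using assms(1) by (simp add: \<mu>_def)
  define \<eta> where "\<eta> = \<epsilon> * \<mu> / 2"
  have "\<eta> > 0"
    using \<open>\<epsilon> > 0\<close> \<open>\<mu> > 0\<close> by (simp add: \<eta>_def)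
  from tendstoD[OF w this] obtain t1 where t1: "\<And>t. t \<ge> t1 \<Longrightarrow> norm (w t) < \<eta>"
    by (auto simp: eventually_at_top_linorder)
  define t0 where "t0 = max 0 t1"
  define v where "v t = exp (- (c * of_real t)) * u t" for t
  have norm_v: "norm (v t) = exp (\<mu> * t) * norm (u t)" for t
    by (simp add: v_def norm_mult \<mu>_def)
  have dv: "(v has_vector_derivative exp (- (c * of_real t)) * w t) (at t)" if "t \<ge> 0" for t
  proof -
    have "((\<lambda>t. exp (- (c * of_real t))) has_vector_derivative - c * exp (- (c * of_real t))) (at t)"
      by (rule has_vector_derivative_real_field) (auto intro!: derivative_eq_intros)
    from has_vector_derivative_mult[OF this u[OF that]] show ?thesis
      unfolding v_def by (simp add: algebra_simps)
  qed
  have bound: "norm (u t) \<le> exp (- (\<mu> * t)) * norm (v t0) + \<epsilon> / 2" if "t > t0" for t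
  proof -
    have "norm (v t - v t0) \<le> \<eta> / \<mu> * exp (\<mu> * t) - \<eta> / \<mu> * exp (\<mu> * t0)"
    proof (rule differentiable_bound_general[OF that])
      show "continuous_on {t0..t} v"
        by (intro continuous_at_imp_continuous_on ballI)
          (use dv in \<open>auto simp: t0_def intro: has_vector_derivative_continuous\<close>)
      show "continuous_on {t0..t} (\<lambda>t. \<eta> / \<mu> * exp (\<mu> * t))"
        by (intro continuous_intros)
      fix x assume x: "t0 < x" "x < t"
      then show "(v has_vector_derivative exp (- (c * of_real x)) * w x) (at x)"
        by (intro dv) (auto simp: t0_def)
      show "((\<lambda>t. \<eta> / \<mu> * exp (\<mu> * t)) has_vector_derivative \<eta> * exp (\<mu> * x)) (at x)"
        unfolding has_real_derivative_iff_has_vector_derivative[symmetric]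
        using \<open>\<mu> > 0\<close> by (auto intro!: derivative_eq_intros)
      show "norm (exp (- (c * of_real x)) * w x) \<le> \<eta> * exp (\<mu> * x)"
        using t1[of x] x by (simp add: norm_mult \<mu>_def t0_def)
    qed
    moreover have "0 \<le> \<eta> / \<mu> * exp (\<mu> * t0)"
      using \<open>\<eta> > 0\<close> \<open>\<mu> > 0\<close> by simp
    ultimately have "norm (v t) \<le> norm (v t0) + \<eta> / \<mu> * exp (\<mu> * t)"
      using norm_triangle_sub[of "v t" "v t0"] by linarith
    then have "exp (- (\<mu> * t)) * norm (v t)
        \<le> exp (- (\<mu> * t)) * (norm (v t0) + \<eta> / \<mu> * exp (\<mu> * t))"
      by (rule mult_left_mono) simp
    then show ?thesis
      unfolding norm_v[of t] using \<open>\<mu> > 0\<close>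
      by (simp add: algebra_simps exp_minus \<eta>_def field_simps)
  qed
  have "((\<lambda>t. exp (- (\<mu> * t)) * norm (v t0) + \<epsilon> / 2) \<longlongrightarrow> 0 * norm (v t0) + \<epsilon> / 2) at_top"
    by (intro tendsto_intros filterlim_compose[OF exp_at_bot])
       (simp add: filterlim_uminus_at_top[symmetric]
         filterlim_tendsto_pos_mult_at_top[OF tendsto_const \<open>\<mu> > 0\<close> filterlim_ident])
  then have "\<forall>\<^sub>F t in at_top. exp (- (\<mu> * t)) * norm (v t0) + \<epsilon> / 2 < \<epsilon>"
    by (rule order_tendstoD) (use \<open>\<epsilon> > 0\<close> in auto)
  then show "\<forall>\<^sub>F t in at_top. dist (u t) 0 < \<epsilon>"
    using eventually_gt_at_top[of t0]
  proof eventually_elim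
    case (elim t)
    then show ?case
      using bound[of t] by simp
  qed
qed

lemma bounded_linear_matrix_vector_mult: "bounded_linear ((*v) (A :: complex^'n^'m))"
  by (rule linear_conv_bounded_linear[THEN iffD1])
    (auto intro!: linearI simp: matrix_vector_right_distrib vec_eq_iff matrix_vector_mult_def sum_distrib_left
       scaleR_conv_of_real algebra_simps scaleR_sum_right)

lemma hurwitz_decay_vector:
  fixes A :: "complex^'m^'m" and e :: "real \<Rightarrow> complex^'m"
  assumes "hurwitz A"
    and e: "\<And>t. 0 \<le> t \<Longrightarrow> (e has_vector_derivative A *v e t) (at t)"
  shows "(e \<longlongrightarrow> 0) at_top"
proof -
  obtain as where as: "\<And>v. shifts A as v = 0"
    and eig: "\<And>a. a \<in> set as \<Longrightarrow> \<exists>v. v \<noteq> 0 \<and> A *v v = a *s v"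
    using eigenvalue_shifts_annihilate[of A] by blast
  have neg: "Re a < 0" if "a \<in> set as" for a
    using eig[OF that] \<open>hurwitz A\<close> by (auto simp: hurwitz_def)
  have lin: "bounded_linear (shifts A bs)" for bs
  proof (induction bs)
    case (Cons b bs)
    have "bounded_linear (\<lambda>v. b *s v :: complex^'m)"
      by (rule linear_conv_bounded_linear[THEN iffD1])
        (auto intro!: linearI simp: vector_add_ldistrib vec_eq_iff scaleR_conv_of_real)
    from bounded_linear_compose[OF this Cons]
    show ?case
      using bounded_linear_compose[OF bounded_linear_matrix_vector_mult[of A] Cons]
      by (auto simp: fun_eq_iff intro!: bounded_linear_sub)
  qed (simp add: bounded_linear_ident)
  \<comment> \<open>removing the factors one by one, each step solves a scalar equation forced by a decaying term\<close>
  have "((\<lambda>t. shifts A bs (e t)) \<longlongrightarrow> 0) at_top" if "cs @ bs = as" for cs bs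
    using that
  proof (induction cs arbitrary: bs rule: rev_induct)
    case Nil
    then show ?case
      by (simp add: as)
  next
    case (snoc b cs)
    define u where "u t = shifts A bs (e t)" for t
    define w where "w t = shifts A (b # bs) (e t)" for t
    have "b \<in> set as"
      using snoc.prems by auto
    have "(w \<longlongrightarrow> 0) at_top"
      unfolding w_def using snoc by (simp del: shifts_Cons)
    have du: "(u has_vector_derivative b *s u t + w t) (at t)" if "0 \<le> t" for t
      using bounded_linear.has_vector_derivative[OF lin[of bs] e[OF that]]
      by (simp add: u_def[abs_def] w_def shifts_matrix)
    have "((\<lambda>t. u t $ i) \<longlongrightarrow> 0) at_top" for i
    proof (rule perturbed_decay[OF neg[OF \<open>b \<in> set as\<close>]])
      show "((\<lambda>t. u t $ i) has_vector_derivative b * u t $ i + w t $ i) (at t)" if "0 \<le> t" for t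
        using bounded_linear.has_vector_derivative[OF bounded_linear_vec_nth du[OF that]] by simp
      show "((\<lambda>t. w t $ i) \<longlongrightarrow> 0) at_top"
        using tendsto_vec_nth[OF \<open>(w \<longlongrightarrow> 0) at_top\<close>] by simp
    qed
    then show ?case
      unfolding u_def[symmetric] by (intro vec_tendstoI) simp
  qed
  from this[of as "[]"] show ?thesis
    by simp
qed

section \<open>Extension with a modulus of continuity\<close>

lemma near_point_exists:
  fixes S :: "'a::metric_space set"
  assumes "closed S" "S \<noteq> {}" "z \<notin> S"
  obtains r y where "r > 0" "y \<in> S" "dist z y < 2 * r" "\<And>w. w \<in> S \<Longrightarrow> r \<le> dist z w"
proof
  have pos: "infdist z S > 0"
    using assms in_closed_iff_infdist_zero infdist_nonneg by (metis less_eq_real_def)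
  then have "infdist z S < 2 * infdist z S"
    by simp
  then have "\<exists>y\<in>S. dist z y < 2 * infdist z S"
    unfolding infdist_def using \<open>S \<noteq> {}\<close> by (simp add: cINF_less_iff)
  then show "(SOME y. y \<in> S \<and> dist z y < 2 * infdist z S) \<in> S"
    "dist z (SOME y. y \<in> S \<and> dist z y < 2 * infdist z S) < 2 * infdist z S"
    by (metis (mono_tags, lifting) someI_ex)+
  show "infdist z S > 0" by (fact pos)
  show "infdist z S \<le> dist z w" if "w \<in> S" for w
    using that by (rule infdist_le)
qed

text \<open>Dugundji's construction, keeping track of the modulus of continuity at the points of \<open>S\<close>.\<close>

lemma extension_with_modulus:
  fixes g :: "'a::{metric_space,second_countable_topology} \<Rightarrow> 'b::real_normed_vector"
  assumes "closed S" "S \<noteq> {}"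
    and modulus: "\<And>y y'. y \<in> S \<Longrightarrow> y' \<in> S \<Longrightarrow> norm (g y - g y') \<le> \<rho> (dist y y')"
    and mono: "\<And>s t. 0 \<le> s \<Longrightarrow> s \<le> t \<Longrightarrow> \<rho> s \<le> \<rho> t"
    and lim: "(\<rho> \<longlongrightarrow> 0) (at_right 0)"
  obtains G where "continuous_on UNIV G" "range G \<subseteq> convex hull (g ` S)"
    "\<And>y. y \<in> S \<Longrightarrow> G y = g y"
    "\<And>z y. y \<in> S \<Longrightarrow> norm (G z - g y) \<le> \<rho> (4 * dist z y)"
proof -
  have "\<exists>r y. z \<notin> S \<longrightarrow> r > 0 \<and> y \<in> S \<and> dist z y < 2 * r \<and> (\<forall>w\<in>S. r \<le> dist z w)" for z
    using near_point_exists[OF assms(1,2), of z] by metis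
  then obtain r p where rp: "\<And>z. z \<notin> S \<Longrightarrow> r z > 0 \<and> p z \<in> S \<and> dist z (p z) < 2 * r z \<and> (\<forall>w\<in>S. r z \<le> dist z w)"
    by metis
  let ?cover = "(\<lambda>z. ball z (r z / 4)) ` (- S)"
  have covers: "- S \<subseteq> \<Union>?cover"
    using rp by force
  have opens: "open V" if "V \<in> ?cover" for V
    using that by auto
  show thesis
  proof (rule paracompact[OF covers opens])
    fix \<C>
    assume cov: "- S \<subseteq> \<Union>\<C>"
      and ref: "\<And>U. U \<in> \<C> \<Longrightarrow> open U \<and> (\<exists>V. V \<in> ?cover \<and> U \<subseteq> V)"
      and fin: "\<And>x. x \<in> - S \<Longrightarrow> \<exists>V. open V \<and> x \<in> V \<and> finite {U. U \<in> \<C> \<and> U \<inter> V \<noteq> {}}"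
    have op: "open U" if "U \<in> \<C>" for U
      using ref[OF that] by simp
    show thesis
    proof (rule subordinate_partition_of_unity[OF cov op fin])
      fix H :: "'a set \<Rightarrow> 'a \<Rightarrow> real"
      assume H_cont: "\<And>U. U \<in> \<C> \<Longrightarrow> continuous_on (- S) (H U) \<and> (\<forall>x\<in>- S. 0 \<le> H U x)"
        and H_out: "\<And>x U. \<lbrakk>U \<in> \<C>; x \<in> - S; x \<notin> U\<rbrakk> \<Longrightarrow> H U x = 0"
        and H_sum: "\<And>x. x \<in> - S \<Longrightarrow> supp_sum (\<lambda>W. H W x) \<C> = 1"
        and H_fin: "\<And>x. x \<in> - S \<Longrightarrow> \<exists>V. open V \<and> x \<in> V \<and> finite {U \<in> \<C>. \<exists>x\<in>V. H U x \<noteq> 0}"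
      have "\<exists>z. z \<notin> S \<and> U \<subseteq> ball z (r z / 4)" if "U \<in> \<C>" for U
        using ref[OF that] by blast
      then obtain c where c: "\<And>U. U \<in> \<C> \<Longrightarrow> c U \<notin> S \<and> U \<subseteq> ball (c U) (r (c U) / 4)"
        by metis
      define a where "a U = g (p (c U))" for U
      have a_in: "a U \<in> g ` S" if "U \<in> \<C>" for U
        using c[OF that] rp[of "c U"] by (auto simp: a_def)
      have a_near: "norm (a U - g y) \<le> \<rho> (4 * dist z y)" if "U \<in> \<C>" "z \<in> U" "y \<in> S" for U z y
      proof -
        have cz: "dist (c U) z < r (c U) / 4" and cp: "dist (c U) (p (c U)) < 2 * r (c U)"
          and cy: "r (c U) \<le> dist (c U) y"
          using c[OF that(1)] that rp[of "c U"] by auto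
        have "dist (c U) y \<le> dist (c U) z + dist z y"
          by (rule dist_triangle)
        moreover have "dist (p (c U)) y \<le> dist (c U) (p (c U)) + dist (c U) z + dist z y"
          using dist_triangle[of "p (c U)" y "c U"] dist_triangle[of "c U" y z] by (simp add: dist_commute)
        ultimately have "dist (p (c U)) y \<le> 4 * dist z y"
          using cz cp cy by linarith
        moreover have "norm (a U - g y) \<le> \<rho> (dist (p (c U)) y)"
          unfolding a_def using c[OF that(1)] rp[of "c U"] that by (intro modulus) auto
        ultimately show ?thesis
          using mono[of "dist (p (c U)) y" "4 * dist z y"] by simp
      qed
      define G where "G z = (if z \<in> S then g z else supp_sum (\<lambda>U. H U z *\<^sub>R a U) \<C>)" for z
      have G_in: "G z \<in> C" if "z \<notin> S" "convex C" and C: "\<And>U. U \<in> \<C> \<Longrightarrow> z \<in> U \<Longrightarrow> a U \<in> C" for z C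
      proof -
        have "supp_sum (\<lambda>U. H U z *\<^sub>R a U) \<C> \<in> C"
        proof (rule convex_supp_sum[OF \<open>convex C\<close>])
          show "supp_sum (\<lambda>U. H U z) \<C> = 1"
            using H_sum that by simp
          show "0 \<le> H U z \<and> (H U z = 0 \<or> a U \<in> C)" if "U \<in> \<C>" for U
            using H_cont[OF that] H_out[OF that, of z] C[OF that] \<open>z \<notin> S\<close> by auto
        qed
        then show ?thesis
          using that by (simp add: G_def)
      qed
      have G_near: "norm (G z - g y) \<le> \<rho> (4 * dist z y)" if "y \<in> S" for z y
      proof (cases "z \<in> S")
        case True
        then have "norm (G z - g y) \<le> \<rho> (dist z y)"
          using modulus that by (simp add: G_def)
        then show ?thesis
          using mono[of "dist z y" "4 * dist z y"] by simp
      next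
        case False
        have "G z \<in> cball (g y) (\<rho> (4 * dist z y))"
          using a_near that by (intro G_in False) (auto simp: dist_norm norm_minus_commute)
        then show ?thesis
          by (simp add: dist_norm norm_minus_commute)
      qed
      have "isCont G z" for z
      proof (cases "z \<in> S")
        case True
        have "((\<lambda>w. norm (G w - G z)) \<longlongrightarrow> 0) (at z)"
        proof (rule tendsto_sandwich[OF always_eventually always_eventually tendsto_const])
          show "\<forall>w. norm (G w - G z) \<le> \<rho> (4 * dist w z)"
            using G_near[OF True] True by (simp add: G_def)
          have "filterlim (\<lambda>w. 4 * dist w z) (at_right 0) (at z)"
            unfolding filterlim_at by (auto intro!: tendsto_eq_intros simp: eventually_at_filter)
          with lim show "((\<lambda>w. \<rho> (4 * dist w z)) \<longlongrightarrow> 0) (at z)"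
            by (rule filterlim_compose)
        qed simp
        then show ?thesis
          by (simp add: isCont_def LIM_zero_iff tendsto_norm_zero_iff)
      next
        case False
        then obtain V where V: "open V" "z \<in> V" "finite {U \<in> \<C>. \<exists>x\<in>V. H U x \<noteq> 0}"
          using H_fin by blast
        let ?F = "{U \<in> \<C>. \<exists>x\<in>V. H U x \<noteq> 0}"
        have "continuous_on (V - S) (\<lambda>w. \<Sum>U\<in>?F. H U w *\<^sub>R a U)"
          using H_cont by (intro continuous_intros) (auto intro: continuous_on_subset)
        moreover have "(\<Sum>U\<in>?F. H U w *\<^sub>R a U) = G w" if "w \<in> V - S" for w
          using that unfolding G_def supp_sum_def
          by (auto simp: support_on_def intro!: sum.mono_neutral_right[OF V(3)])
        ultimately have "continuous_on (V - S) G"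
          by (rule continuous_on_eq)
        moreover have "open (V - S)" "z \<in> V - S"
          using V \<open>closed S\<close> False by auto
        ultimately show ?thesis
          by (simp add: continuous_on_eq_continuous_at)
      qed
      then have "continuous_on UNIV G"
        by (simp add: continuous_at_imp_continuous_on)
      moreover have "G z \<in> convex hull (g ` S)" for z
      proof (cases "z \<in> S")
        case True
        then show ?thesis
          by (simp add: G_def hull_inc)
      next
        case False
        then show ?thesis
          using a_in by (intro G_in convex_convex_hull) (auto intro: hull_inc)
      qed
      moreover have "G y = g y" if "y \<in> S" for y
        using that by (simp add: G_def)
      ultimately show thesis
        using that[of G] G_near by blast
    qed
  qed auto
qed

section \<open>The observer\<close>

lemma bounded_linear_matrix_mult: "bounded_linear ((**) (A :: complex^'n^'m) :: complex^'p^'n \<Rightarrow> complex^'p^'m)"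
proof (rule linear_conv_bounded_linear[THEN iffD1], rule linearI)
  show "A ** (r *\<^sub>R M) = r *\<^sub>R (A ** M)" for r and M :: "complex^'p^'n"
    by (simp add: vec_eq_iff matrix_matrix_mult_def scaleR_sum_right)
qed (simp add: matrix_add_ldistrib)

lemma matrix_mult_diff_right: "A ** (M - N) = A ** M - A ** N" for A :: "complex^'n^'m"
  by (simp add: vec_eq_iff matrix_matrix_mult_def algebra_simps sum_subtractf)

lemma matrix_mult_bounded:
  fixes A :: "complex^'n^'m"
  shows "\<exists>L. \<forall>M :: complex^'p^'n. norm (A ** M) \<le> L * norm M"
proof -
  obtain L where "\<forall>M :: complex^'p^'n. norm (A ** M) \<le> norm M * L"
    using bounded_linear.bounded[OF bounded_linear_matrix_mult[of A]] ..
  then show ?thesis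
    unfolding mult.commute[of "norm _"] ..
qed

lemma hurwitz_decay:
  fixes A :: "complex^'m^'m" and E :: "real \<Rightarrow> complex^'p^'m"
  assumes "hurwitz A"
    and E: "\<And>t. 0 \<le> t \<Longrightarrow> (E has_vector_derivative A ** E t) (at t)"
  shows "(E \<longlongrightarrow> 0) at_top"
proof -
  have column: "((\<lambda>t. column j (E t)) \<longlongrightarrow> 0) at_top" for j
  proof (rule hurwitz_decay_vector[OF \<open>hurwitz A\<close>])
    fix t :: real assume "0 \<le> t"
    have "bounded_linear (column j :: complex^'p^'m \<Rightarrow> complex^'m)"
      by (rule linear_conv_bounded_linear[THEN iffD1], rule linearI) (simp_all add: column_def vec_eq_iff)
    from bounded_linear.has_vector_derivative[OF this E[OF \<open>0 \<le> t\<close>]]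
    show "((\<lambda>t. column j (E t)) has_vector_derivative A *v column j (E t)) (at t)"
      by (simp add: column_def matrix_matrix_mult_def matrix_vector_mult_def)
  qed
  have "((\<lambda>t. E t $ i $ j) \<longlongrightarrow> 0) at_top" for i j
    using tendsto_vec_nth[OF column[of j], of i] by (simp add: column_def)
  then show ?thesis
    by (intro vec_tendstoI) simp
qed

lemma unique_maximal_solution_cong:
  assumes "unique_maximal_solution g S x I \<phi>" "\<And>t. t \<in> I \<Longrightarrow> \<psi> t = \<phi> t"
  shows "unique_maximal_solution g S x I \<psi>"
proof -
  have "solution g S x I \<phi>"
    using assms(1) by (simp add: unique_maximal_solution_def maximal_solution_def)
  then have "solution g S x I \<psi>"
    using assms(2) by (rule solution_cong)
  then show ?thesis
    using assms by (simp add: unique_maximal_solution_def maximal_solution_def)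
qed

lemma
  assumes "solution (observer_field f h A B) UNIV (x, z) J \<Phi>"
  shows solution_observer_fst: "solution f UNIV x J (\<lambda>t. fst (\<Phi> t))"
    and solution_observer_snd: "t \<in> J \<Longrightarrow>
      ((\<lambda>t. snd (\<Phi> t)) has_vector_derivative A ** snd (\<Phi> t) + B (h (fst (\<Phi> t)))) (at t)"
    and solution_observer_snd_0: "snd (\<Phi> 0) = z"
proof -
  have "(\<Phi> has_vector_derivative (f (fst (\<Phi> t)), A ** snd (\<Phi> t) + B (h (fst (\<Phi> t))))) (at t)"
    if "t \<in> J" for t
    using assms that by (simp add: solution_def observer_field_def case_prod_beta)
  note deriv = bounded_linear.has_vector_derivative[OF bounded_linear_fst this]
    bounded_linear.has_vector_derivative[OF bounded_linear_snd this]
  show "solution f UNIV x J (\<lambda>t. fst (\<Phi> t))"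
    using assms deriv(1) by (simp add: solution_def)
  show "((\<lambda>t. snd (\<Phi> t)) has_vector_derivative A ** snd (\<Phi> t) + B (h (fst (\<Phi> t)))) (at t)" if "t \<in> J"
    using deriv(2)[OF that] by simp
  show "snd (\<Phi> 0) = z"
    using assms by (simp add: solution_def)
qed

lemma observer_solutions_agree:
  fixes f :: "real^'n \<Rightarrow> real^'n" and B :: "real^'p \<Rightarrow> complex^'p^'m"
  assumes f: "local_lipschitz (UNIV :: real set) UNIV (\<lambda>_. f)"
    and \<Phi>: "solution (observer_field f h A B) UNIV (x, z) J \<Phi>" "t \<in> J"
    and \<Psi>: "solution (observer_field f h A B) UNIV (x, z) K \<Psi>" "t \<in> K"
  shows "\<Phi> t = \<Psi> t"
proof -
  have fst_eq: "fst (\<Phi> s) = fst (\<Psi> s)" if "s \<in> J" "s \<in> K" for s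
    using solutions_agree[OF f solution_observer_fst[OF \<Phi>(1)] solution_observer_fst[OF \<Psi>(1)] that] .
  have sub: "closed_segment 0 t \<subseteq> J" "closed_segment 0 t \<subseteq> K"
    using solution_segment \<Phi> \<Psi> by blast+
  obtain L where L: "\<And>M :: complex^'p^'m. norm (A ** M) \<le> L * norm M"
    using matrix_mult_bounded[of A] by blast
  let ?D = "\<lambda>s. snd (\<Phi> s) - snd (\<Psi> s)"
  have "?D t = 0"
  proof (rule deriv_bound_imp_zero[where D = ?D])
    show "?D 0 = 0"
      using solution_observer_snd_0[OF \<Phi>(1)] solution_observer_snd_0[OF \<Psi>(1)] by simp
    fix s assume "s \<in> closed_segment 0 t"
    then have s: "s \<in> J" "s \<in> K"
      using sub by auto
    show "(?D has_vector_derivative A ** ?D s) (at s)"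
      using has_vector_derivative_diff[OF solution_observer_snd[OF \<Phi>(1) s(1)] solution_observer_snd[OF \<Psi>(1) s(2)]]
      by (simp add: fst_eq[OF s] matrix_mult_diff_right)
    show "norm (A ** ?D s) \<le> L * norm (?D s)"
      by (rule L)
  qed
  then show ?thesis
    using fst_eq[OF \<Phi>(2) \<Psi>(2)] by (simp add: prod_eq_iff)
qed

lemma observer_solution_exists:
  fixes f :: "real^'n \<Rightarrow> real^'n" and B :: "real^'p \<Rightarrow> complex^'p^'m"
  assumes cont: "continuous_on UNIV (\<lambda>x. B (h x))"
    and sol: "solution f UNIV x I \<phi>" and "t \<in> I"
  obtains J \<Phi> where "solution (observer_field f h A B) UNIV (x, z) J \<Phi>" "t \<in> J"
proof -
  have I: "open I" "is_interval I" "0 \<in> I"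
    using sol by (simp_all add: solution_def)
  have "min 0 t \<in> I" "max 0 t \<in> I"
    using \<open>0 \<in> I\<close> \<open>t \<in> I\<close> by (auto simp: min_def max_def)
  then obtain d e where "d > 0" "cball (min 0 t) d \<subseteq> I" "e > 0" "cball (max 0 t) e \<subseteq> I"
    using \<open>open I\<close> open_contains_cball by meson
  define a b where "a = min 0 t - d" and "b = max 0 t + e"
  have ab: "a < min 0 t" "a \<in> I" "max 0 t < b" "b \<in> I"
    using \<open>d > 0\<close> \<open>cball (min 0 t) d \<subseteq> I\<close> \<open>e > 0\<close> \<open>cball (max 0 t) e \<subseteq> I\<close>
    by (auto simp: a_def b_def subset_iff dist_real_def)
  then have sub: "{a..b} \<subseteq> I"
    using I(2) unfolding is_interval_1 by (meson atLeastAtMost_iff subsetI)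
  define b' where "b' s = B (h (\<phi> s))" for s
  have cont_b: "continuous_on {a..b} b'"
    unfolding b'_def using solution_continuous_on[OF sol] sub
    by (intro continuous_on_compose2[OF cont]) (auto intro: continuous_on_subset)
  have "bounded (b' ` {a..b})"
    using cont_b by (intro compact_imp_bounded compact_continuous_image) auto
  then obtain C where "\<forall>y\<in>b' ` {a..b}. norm y \<le> C"
    unfolding bounded_iff ..
  then have C: "norm (b' s) \<le> C" if "s \<in> {a..b}" for s
    using that by blast
  obtain L where L: "\<And>M :: complex^'p^'m. norm (A ** M) \<le> L * norm M"
    using matrix_mult_bounded[of A] by blast
  \<comment> \<open>the forcing term is frozen outside \<open>{a..b}\<close> so that it is defined and bounded for all times\<close>
  let ?c = "\<lambda>s. max a (min b s)"
  have c: "?c s \<in> {a..b}" for s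
    using ab by auto
  have "\<exists>u. u 0 = z \<and> (\<forall>s. (u has_vector_derivative A ** u s + b' (?c s)) (at s))"
  proof (rule global_solution_exists)
    show "continuous_on UNIV (\<lambda>s. A ** u s + b' (?c s))" if "continuous_on UNIV u" for u :: "real \<Rightarrow> complex^'p^'m"
      using c by (intro continuous_intros continuous_on_compose2[OF cont_b]
          bounded_linear.continuous_on[OF bounded_linear_matrix_mult] that) auto
    show "norm (A ** v + b' (?c s) - (A ** w + b' (?c s))) \<le> L * norm (v - w)" for s v w
      using L[of "v - w"] by (simp add: matrix_mult_diff_right)
    show "norm (A ** 0 + b' (?c s)) \<le> C" for s
      using C[OF c] by simp
  qed
  then obtain u where u: "u 0 = z" "\<And>s. (u has_vector_derivative A ** u s + b' (?c s)) (at s)"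
    by blast
  have "solution (observer_field f h A B) UNIV (x, z) {a<..<b} (\<lambda>s. (\<phi> s, u s))"
    unfolding solution_def
  proof (intro conjI ballI)
    fix s assume s: "s \<in> {a<..<b}"
    then have "?c s = s" "s \<in> I"
      using sub by auto
    then show "((\<lambda>s. (\<phi> s, u s)) has_vector_derivative observer_field f h A B (\<phi> s, u s)) (at s)"
      using u(2)[of s] sol
      by (auto simp: observer_field_def b'_def solution_def intro!: has_vector_derivative_Pair)
  qed (use ab u(1) sol in \<open>auto simp: solution_def is_interval_oo\<close>)
  then show thesis
    by (rule that) (use ab in auto)
qed

lemma observer_maximal_solution:
  fixes f :: "real^'n \<Rightarrow> real^'n" and B :: "real^'p \<Rightarrow> complex^'p^'m"
  assumes f: "local_lipschitz (UNIV :: real set) UNIV (\<lambda>_. f)"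
    and cont: "continuous_on UNIV (\<lambda>x. B (h x))"
  obtains Z where
    "unique_maximal_solution (observer_field f h A B) UNIV (x, z) (max_interval f UNIV x) (\<lambda>t. (flow f x t, Z t))"
proof -
  let ?g = "observer_field f h A B" and ?I = "max_interval f UNIV x"
  have flow: "solution f UNIV x ?I (flow f x)"
    by (rule solution_flow[OF f])
  have agree: "\<forall>J \<Phi> K \<Psi>. solution ?g UNIV (x, z) J \<Phi> \<longrightarrow> solution ?g UNIV (x, z) K \<Psi> \<longrightarrow> (\<forall>t\<in>J \<inter> K. \<Phi> t = \<Psi> t)"
    by (intro allI impI ballI, erule IntE) (rule observer_solutions_agree[OF f])
  have "0 \<in> ?I"
    using flow by (simp add: solution_def)
  then obtain J0 \<Phi>0 where sol: "solution ?g UNIV (x, z) J0 \<Phi>0"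
    by (rule observer_solution_exists[OF cont flow])
  from unique_maximal_solution_exists[OF agree sol] obtain J \<Phi> where J: "unique_maximal_solution ?g UNIV (x, z) J \<Phi>"
    and ext: "\<And>K \<Psi>. solution ?g UNIV (x, z) K \<Psi> \<Longrightarrow> K \<subseteq> J \<and> (\<forall>t\<in>K. \<Psi> t = \<Phi> t)"
    by blast
  have "solution ?g UNIV (x, z) J \<Phi>"
    using J by (simp add: unique_maximal_solution_def maximal_solution_def)
  then have fst: "solution f UNIV x J (\<lambda>t. fst (\<Phi> t))"
    by (rule solution_observer_fst)
  have fst_flow: "J \<subseteq> ?I" "\<And>t. t \<in> J \<Longrightarrow> fst (\<Phi> t) = flow f x t"
    using solution_imp_flow[OF f fst] by auto
  have "?I \<subseteq> J"
  proof
    fix t assume "t \<in> ?I"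
    from observer_solution_exists[OF cont flow this] ext show "t \<in> J"
      by blast
  qed
  with fst_flow(1) have "J = ?I"
    by simp
  moreover have "unique_maximal_solution ?g UNIV (x, z) J (\<lambda>t. (flow f x t, snd (\<Phi> t)))"
    by (rule unique_maximal_solution_cong[OF J]) (simp add: prod_eq_iff fst_flow)
  ultimately show thesis
    using that by simp
qed

lemma interval_eq_less_SUP:
  fixes I :: "real set"
  assumes "open I" "is_interval I" "0 \<in> I"
  shows "I \<inter> {0..} = {t. 0 \<le> t \<and> ereal t < (SUP s\<in>I. ereal s)}"
proof (intro set_eqI iffI)
  fix t assume t: "t \<in> I \<inter> {0..}"
  then obtain b where "t < b" "{t..<b} \<subseteq> I"
    using open_right[OF \<open>open I\<close>, of t "t + 1"] by auto
  then have "(t + b) / 2 \<in> I" "t < (t + b) / 2"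
    by auto
  then have "\<exists>s\<in>I. t < s"
    by blast
  then show "t \<in> {t. 0 \<le> t \<and> ereal t < (SUP s\<in>I. ereal s)}"
    using t by (auto simp: less_SUP_iff)
next
  fix t assume t: "t \<in> {t. 0 \<le> t \<and> ereal t < (SUP s\<in>I. ereal s)}"
  then obtain s where "s \<in> I" "t < s"
    by (auto simp: less_SUP_iff)
  with t mem_is_interval_1_I[OF assms(2,3), of s t] show "t \<in> I \<inter> {0..}"
    by auto
qed

lemma flow_stays_within:
  fixes f :: "'a::euclidean_space \<Rightarrow> 'a"
  assumes f: "local_lipschitz (UNIV :: real set) UNIV (\<lambda>_. f)" and "open S" "x \<in> S"
    and "sigma_plus f S x = \<infinity>" "0 \<le> t"
  shows "t \<in> max_interval f UNIV x" "flow f x t \<in> S"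
proof -
  obtain \<phi> where "maximal_solution f S x (max_interval f S x) \<phi>"
    using local_lipschitz_maximal_solution[OF f \<open>open S\<close> \<open>x \<in> S\<close>] by blast
  then have sol: "solution f S x (max_interval f S x) \<phi>"
    by (simp add: maximal_solution_def)
  then have "t \<in> max_interval f S x"
    using interval_eq_less_SUP[of "max_interval f S x"] assms(4,5)
    by (auto simp: solution_def sigma_plus_def)
  with sol solution_imp_flow[OF f sol] show "t \<in> max_interval f UNIV x" "flow f x t \<in> S"
    by (auto simp: solution_def)
qed

lemma has_vector_derivative_difference_quotient:
  assumes "((\<lambda>\<tau>. (u (t + \<tau>) - u t) /\<^sub>R \<tau>) \<longlongrightarrow> D) (at 0)"
  shows "(u has_vector_derivative D) (at t)"
  unfolding has_vector_derivative_def has_derivative_at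
proof
  have "((\<lambda>\<tau>. norm ((u (t + \<tau>) - u t) /\<^sub>R \<tau> - D)) \<longlongrightarrow> 0) (at 0)"
    using assms by (simp add: LIM_zero_iff tendsto_norm_zero_iff)
  then show "((\<lambda>\<tau>. norm (u (t + \<tau>) - u t - \<tau> *\<^sub>R D) / norm \<tau>) \<longlongrightarrow> 0) (at 0)"
  proof (rule Lim_transform_eventually)
    have "norm ((u (t + \<tau>) - u t) /\<^sub>R \<tau> - D) = norm (u (t + \<tau>) - u t - \<tau> *\<^sub>R D) / norm \<tau>"
      if "\<tau> \<noteq> 0" for \<tau>
    proof -
      have "u (t + \<tau>) - u t - \<tau> *\<^sub>R D = \<tau> *\<^sub>R ((u (t + \<tau>) - u t) /\<^sub>R \<tau> - D)"
        using that by (simp add: scaleR_diff_right)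
      then show ?thesis
        using that by simp
    qed
    then show "\<forall>\<^sub>F \<tau> in at 0. norm ((u (t + \<tau>) - u t) /\<^sub>R \<tau> - D) = norm (u (t + \<tau>) - u t - \<tau> *\<^sub>R D) / norm \<tau>"
      by (simp add: eventually_at_filter)
  qed
qed (rule bounded_linear_scaleR_left)

lemma lie_derivative_along_flow:
  fixes f :: "'a::euclidean_space \<Rightarrow> 'a"
  assumes f: "local_lipschitz (UNIV :: real set) UNIV (\<lambda>_. f)"
    and t: "t \<in> max_interval f UNIV x"
    and lie: "has_lie_derivative T f D (flow f x t)"
  shows "((\<lambda>t. T (flow f x t)) has_vector_derivative D) (at t)"
proof (rule has_vector_derivative_difference_quotient)
  let ?I = "max_interval f UNIV x"
  have "open ?I"
    using solution_flow[OF f] by (simp add: solution_def)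
  moreover have "((\<lambda>\<tau>. t + \<tau>) \<longlongrightarrow> t) (at 0)"
    by (auto intro!: tendsto_eq_intros)
  ultimately have "\<forall>\<^sub>F \<tau> in at 0. t + \<tau> \<in> ?I"
    using t by (auto elim: topological_tendstoD)
  then have "\<forall>\<^sub>F \<tau> in at 0. (T (flow f (flow f x t) \<tau>) - T (flow f x t)) /\<^sub>R \<tau>
      = (T (flow f x (t + \<tau>)) - T (flow f x t)) /\<^sub>R \<tau>"
    by eventually_elim (simp add: flow_add[OF f t])
  with lie show "((\<lambda>\<tau>. (T (flow f x (t + \<tau>)) - T (flow f x t)) /\<^sub>R \<tau>) \<longlongrightarrow> D) (at 0)"
    unfolding has_lie_derivative_def by (rule Lim_transform_eventually)
qed

lemma class_K_inf_mono:
  assumes "class_K_inf \<rho>" "0 \<le> s" "s \<le> t"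
  shows "\<rho> s \<le> \<rho> t"
proof -
  have "strict_mono_on {0..} \<rho>"
    using assms(1) by (simp add: class_K_inf_def)
  from strict_mono_on_leD[OF this, of s t] show ?thesis
    using assms(2,3) by simp
qed

lemma closed_expanding_image:
  fixes T :: "'a::complete_space \<Rightarrow> 'b::metric_space"
  assumes "closed S" "continuous_on S T"
    and \<rho>: "continuous_on {0..} \<rho>" "\<rho> 0 = (0::real)"
    and expand: "\<And>x y. x \<in> S \<Longrightarrow> y \<in> S \<Longrightarrow> dist x y \<le> \<rho> (dist (T x) (T y))"
  shows "closed (T ` S)"
  unfolding closed_sequential_limits
proof (intro allI impI, elim conjE)
  fix y l assume y: "\<forall>n. y n \<in> T ` S" and lim_y: "y \<longlonglongrightarrow> l"
  then have "\<forall>n. \<exists>x. x \<in> S \<and> y n = T x"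
    by blast
  then obtain x where x: "\<And>n. x n \<in> S" "\<And>n. y n = T (x n)"
    by metis
  have "Cauchy x"
  proof (rule metric_CauchyI)
    fix e :: real assume "e > 0"
    with \<rho>(1) obtain d where "d > 0" and "\<forall>s\<in>{0..}. dist s 0 < d \<longrightarrow> dist (\<rho> s) (\<rho> 0) < e"
      unfolding continuous_on_iff by (metis atLeast_iff order_refl)
    then have d: "\<rho> s < e" if "0 \<le> s" "s < d" for s
      using that \<rho>(2) by (auto simp: dist_real_def)
    from metric_CauchyD[OF LIMSEQ_imp_Cauchy[OF lim_y] \<open>d > 0\<close>] obtain M
      where M: "\<And>m n. \<lbrakk>m \<ge> M; n \<ge> M\<rbrakk> \<Longrightarrow> dist (y m) (y n) < d"
      by blast
    have "dist (x m) (x n) < e" if "m \<ge> M" "n \<ge> M" for m n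
      using expand[OF x(1) x(1), of m n] d[OF zero_le_dist M[OF that]] by (simp add: x(2))
    then show "\<exists>M. \<forall>m\<ge>M. \<forall>n\<ge>M. dist (x m) (x n) < e"
      by blast
  qed
  then obtain a where a: "x \<longlonglongrightarrow> a"
    by (auto simp: Cauchy_convergent_iff convergent_def)
  with \<open>closed S\<close> x(1) have "a \<in> S"
    by (rule closed_sequentially)
  then have "(\<lambda>n. T (x n)) \<longlonglongrightarrow> T a"
    using continuous_on_tendsto_compose[OF \<open>continuous_on S T\<close> a] x(1) by simp
  then have "l = T a"
    using lim_y x(2) by (metis LIMSEQ_unique ext)
  with \<open>a \<in> S\<close> show "l \<in> T ` S"
    by simp
qed

theorem theorem2p2:
  fixes f :: "real^'n \<Rightarrow> real^'n"
    and h :: "real^'n \<Rightarrow> real^'p"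
    and \<O> :: "(real^'n) set"
    and A :: "complex^'m^'m"
    and T :: "real^'n \<Rightarrow> complex^'p^'m"
    and B :: "real^'p \<Rightarrow> complex^'p^'m"
    and \<rho> :: "real \<Rightarrow> real"
  assumes "local_lipschitz (UNIV :: real set) UNIV (\<lambda>_. f)"
    and "local_lipschitz (UNIV :: real set) UNIV (\<lambda>_. h)"
    and "open \<O>" and "\<O> \<noteq> {}"
    and "forward_complete_within f \<O>"
    and "hurwitz A"
    and "continuous_on (closure \<O>) T"
    and "continuous_on UNIV B"
    and "class_K_inf \<rho>"
    and "\<forall>x\<in>\<O>. has_lie_derivative T f (A ** T x + B (h x)) x"
    and "\<forall>x1\<in>closure \<O>. \<forall>x2\<in>closure \<O>. norm (x1 - x2) \<le> \<rho> (norm (T x1 - T x2))"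
  shows "\<exists>Tstar :: complex^'p^'m \<Rightarrow> real^'n.
    continuous_on UNIV Tstar \<and>
    range Tstar \<subseteq> convex hull (closure \<O>) \<and>
    Tstar ` T ` closure \<O> \<subseteq> closure \<O> \<and>
    (\<forall>x\<in>\<O>. \<forall>z. \<exists>I Z.
      unique_maximal_solution (observer_field f h A B) UNIV (x, z) I (\<lambda>t. (flow f x t, Z t)) \<and>
      I \<inter> {0..} = {t. 0 \<le> t \<and> ereal t < sigma_plus f UNIV x} \<and>
      (sigma_plus f \<O> x = sigma_plus f UNIV x \<longrightarrow>
        (((\<lambda>t. norm (Tstar (Z t) - flow f x t)) \<circ> real_of_ereal) \<longlongrightarrow> 0)
          (at_left (sigma_plus f UNIV x))))"
proof -
  note f = assms(1) and lie = assms(10)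
  have \<rho>: "continuous_on {0..} \<rho>" "\<rho> 0 = 0"
    using \<open>class_K_inf \<rho>\<close> by (simp_all add: class_K_inf_def)
  have expand: "dist x y \<le> \<rho> (dist (T x) (T y))" if "x \<in> closure \<O>" "y \<in> closure \<O>" for x y
    using assms(11) that by (simp add: dist_norm)
  then have inj: "inj_on T (closure \<O>)"
    using \<rho>(2) by (fastforce simp: inj_on_def)
  let ?S = "T ` closure \<O>"
  define g where "g = inv_into (closure \<O>) T"
  have g: "g (T x) = x" if "x \<in> closure \<O>" for x
    unfolding g_def using inj that by (rule inv_into_f_f)
  have "closed ?S"
    using closed_closure assms(7) \<rho> expand by (rule closed_expanding_image)
  moreover have "?S \<noteq> {}"
    using \<open>\<O> \<noteq> {}\<close> by simp
  moreover have "norm (g y - g y') \<le> \<rho> (dist y y')" if "y \<in> ?S" "y' \<in> ?S" for y y'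
    using that expand g by (auto simp: dist_norm)
  moreover have "(\<rho> \<longlongrightarrow> 0) (at_right 0)"
  proof -
    have "(\<rho> \<longlongrightarrow> 0) (at 0 within {0..})"
      using \<rho> by (force simp: continuous_on_def)
    then show ?thesis
      by (rule tendsto_within_subset) auto
  qed
  ultimately obtain Tstar where cont: "continuous_on UNIV Tstar"
    and range: "range Tstar \<subseteq> convex hull (g ` ?S)"
    and on_S: "\<And>y. y \<in> ?S \<Longrightarrow> Tstar y = g y"
    and near: "\<And>z y. y \<in> ?S \<Longrightarrow> norm (Tstar z - g y) \<le> \<rho> (4 * dist z y)"
    using extension_with_modulus[of ?S g \<rho>] class_K_inf_mono[OF \<open>class_K_inf \<rho>\<close>] by blast
  have "g ` ?S = closure \<O>"
    using g by (force simp: image_image)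
  with range have "range Tstar \<subseteq> convex hull (closure \<O>)"
    by simp
  moreover have "Tstar ` T ` closure \<O> \<subseteq> closure \<O>"
    using on_S g by (auto simp: image_subset_iff)
  moreover have "\<exists>I Z.
      unique_maximal_solution (observer_field f h A B) UNIV (x, z) I (\<lambda>t. (flow f x t, Z t)) \<and>
      I \<inter> {0..} = {t. 0 \<le> t \<and> ereal t < sigma_plus f UNIV x} \<and>
      (sigma_plus f \<O> x = sigma_plus f UNIV x \<longrightarrow>
        (((\<lambda>t. norm (Tstar (Z t) - flow f x t)) \<circ> real_of_ereal) \<longlongrightarrow> 0)
          (at_left (sigma_plus f UNIV x)))"
    if "x \<in> \<O>" for x z
  proof -
    let ?I = "max_interval f UNIV x" and ?X = "flow f x"
    have "continuous_on UNIV (\<lambda>x. B (h x))"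
      by (rule continuous_on_compose2[OF assms(8) local_lipschitz_continuous_on[OF assms(2) UNIV_I]]) auto
    with f obtain Z where
      Z: "unique_maximal_solution (observer_field f h A B) UNIV (x, z) ?I (\<lambda>t. (?X t, Z t))"
      by (rule observer_maximal_solution)
    have I: "?I \<inter> {0..} = {t. 0 \<le> t \<and> ereal t < sigma_plus f UNIV x}"
      unfolding sigma_plus_def
      by (rule interval_eq_less_SUP) (use solution_flow[OF f, of x] in \<open>auto simp: solution_def\<close>)
    have "(((\<lambda>t. norm (Tstar (Z t) - ?X t)) \<circ> real_of_ereal) \<longlongrightarrow> 0) (at_left (sigma_plus f UNIV x))"
      if eq: "sigma_plus f \<O> x = sigma_plus f UNIV x"
    proof -
      have inf: "sigma_plus f \<O> x = \<infinity>"
        using assms(5) \<open>x \<in> \<O>\<close> eq by (force simp: forward_complete_within_def)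
      have stay: "t \<in> ?I" "?X t \<in> \<O>" if "0 \<le> t" for t
        using flow_stays_within[OF f \<open>open \<O>\<close> \<open>x \<in> \<O>\<close> inf that] by auto
      define E where "E t = Z t - T (?X t)" for t
      have "(E \<longlongrightarrow> 0) at_top"
      proof (rule hurwitz_decay[OF \<open>hurwitz A\<close>])
        fix t :: real assume "0 \<le> t"
        have "solution (observer_field f h A B) UNIV (x, z) ?I (\<lambda>t. (?X t, Z t))"
          using Z by (simp add: unique_maximal_solution_def maximal_solution_def)
        from solution_observer_snd[OF this stay(1)[OF \<open>0 \<le> t\<close>]]
        have dZ: "(Z has_vector_derivative A ** Z t + B (h (?X t))) (at t)"
          by simp
        have "has_lie_derivative T f (A ** T (?X t) + B (h (?X t))) (?X t)"
          using lie stay(2)[OF \<open>0 \<le> t\<close>] by blast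
        from has_vector_derivative_diff[OF dZ lie_derivative_along_flow[OF f stay(1)[OF \<open>0 \<le> t\<close>] this]]
        show "(E has_vector_derivative A ** E t) (at t)"
          by (simp add: E_def[abs_def] matrix_mult_diff_right)
      qed
      then have "((\<lambda>t. 4 * norm (E t)) \<longlongrightarrow> 0) at_top"
        by (auto intro!: tendsto_eq_intros)
      from continuous_on_tendsto_compose[OF \<rho>(1) this]
      have lim: "((\<lambda>t. \<rho> (4 * norm (E t))) \<longlongrightarrow> 0) at_top"
        using \<rho>(2) by simp
      have "((\<lambda>t. norm (Tstar (Z t) - ?X t)) \<longlongrightarrow> 0) at_top"
      proof (rule tendsto_sandwich[OF _ _ tendsto_const lim])
        have "norm (Tstar (Z t) - ?X t) \<le> \<rho> (4 * norm (E t))" if "0 \<le> t" for t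
        proof -
          have "?X t \<in> closure \<O>"
            using stay(2)[OF that] closure_subset by blast
          with near[of "T (?X t)" "Z t"] show ?thesis
            by (simp add: g E_def dist_norm)
        qed
        then show "\<forall>\<^sub>F t in at_top. norm (Tstar (Z t) - ?X t) \<le> \<rho> (4 * norm (E t))"
          by (auto simp: eventually_at_top_linorder)
      qed simp
      then show ?thesis
        using inf eq by (simp add: ereal_tendsto_simps1(3))
    qed
    with Z I show ?thesis
      by blast
  qed
  ultimately show ?thesis
    using cont by blast
qed

end
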